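(* Let $\phi\equiv0$ and $c=-\mu$ with $\mu$ a probability distribution on $\mathcal S$, let $\nu$ be a probability distribution on $\mathcal S$ and $\pi^\star$ a maximizer of $J_\nu$ over $\Pi$. Consider the Markovian proximal Bellman-ADMM iteration described in the context and its companion iterates $\widetilde z^{k+1}=(\pi^{k+1},V^k,\widetilde\lambda^{k+1})$, $\widetilde\lambda^{k+1}=\lambda^k+\beta\widehat R_k(\pi^{k+1},V^k)$. Let $K$ be uniform on $\{0,\dots,T-1\}$, independent of the algorithmic randomness, write $\pi_{\mathrm{out}}=\pi^{K+1}$ and $G=G(\widetilde z^{K+1})$, and suppose that the finite-time bound $\mathbb E[G]\le\frac AT+\frac BT\sum_{k=0}^{T-1}m_k^{-1}$ holds, with constants $A,B>0$ not depending on $T$ or the batch schedule. (i) If the occupancy mismatch is uniformly bounded along the output, $\mathcal C_2(\pi^\star,\pi_{\mathrm{out}},\nu,\mu)\le\bar C_{\mathrm{occ}}<\infty$, then $\mathbb E[J_\nu(\pi^\star)-J_\nu(\pi_{\mathrm{out}})]\le C\sqrt{\mathbb E G}$ for a constant $C$ not depending on $T$ or the batch schedule. Hence $G\to0$ implies convergence to globally optimal policy performance, and every covered exact KKT point (a point with $G(\pi,V,\lambda)=0$ and $\operatorname{supp}d_\nu^{\pi^\star}\subseteq\operatorname{supp}d_\mu^\pi$) is globally optimal under $\nu$. (ii) If the statewise quadratic Bellman-improvement condition holds ($\delta_s^\pi\le\frac1{2\mu_B}\bar r_s(\pi)^2$ for some $\mu_B>0$, for every relevant state $s$ and policy $\pi$)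 and the stronger occupancy ratio $\|d_\nu^{\pi^\star}/(d_\mu^{\pi_{\mathrm{out}}})^2\|_\infty$ is bounded by a finite constant, then $\mathbb E[J_\nu(\pi^\star)-J_\nu(\pi_{\mathrm{out}})]\le C'\,\mathbb E G$ for a constant $C'$ not depending on $T$ or the batch schedule.
   Context: MDP notation: $(\mathcal S,\mathcal A,P,r,\rho,\gamma)$ is a finite discounted MDP, $0<\gamma<1$, $|r(s,a)|\le R_{\max}$. $\Pi=\prod_s\Delta(\mathcal A)\subset\mathbb R^{|\mathcal S||\mathcal A|}$. $P_\pi(s,s')=\sum_a\pi(a|s)P(s'|s,a)$, $r_\pi(s)=\sum_a\pi(a|s)r(s,a)$, $M_\pi=I-\gamma P_\pi$, $R(\pi,V)=M_\pi V-r_\pi$, $J_\pi(\pi,V)=D_\pi R(\pi,V)$, $V^\pi=M_\pi^{-1}r_\pi$, $Q^\pi(s,a)=r(s,a)+\gamma\sum_{s'}P(s'|s,a)V^\pi(s')$, $J_\nu(\pi)=\nu^{\mathsf T}V^\pi$, $d_\mu^\pi=(1-\gamma)M_\pi^{-\mathsf T}\mu$. $N_C(x)$ is the normal cone. Squared KKT residual ($\phi\equiv0$, $c=-\mu$): $G(\pi,V,\lambda)=\operatorname{dist}^2(0,N_\Pi(\pi)+J_\pi(\pi,V)^{\mathsf T}\lambda)+\|M_\pi^{\mathsf T}\lambda-\mu\|^2+\|R(\pi,V)\|^2$. $\bar r_s(\pi)=\operatorname{dist}(0,-Q^\pi(s,\cdot)+N_{\Delta(\mathcal A)}(\pi(\cdot|s)))$;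 $\delta_s^\pi=\max_aQ^\pi(s,a)-V^\pi(s)$. $\mathcal C_2(\pi^\star,\pi,\nu,\mu)=\|d_\nu^{\pi^\star}/d_\mu^\pi\|_2$ (entrywise ratio, $0/0=0$, value $+\infty$ if a numerator is positive and its denominator zero; same convention for $\|d_\nu^{\pi^\star}/(d_\mu^\pi)^2\|_\infty$). In the quadratic-improvement condition the relevant states are those with $d_\nu^{\pi^\star}(s)>0$ and the relevant policies are the values of $\pi_{\mathrm{out}}$. Algorithm: at iteration $k$ a batch of $m_k$ Markov samples produces row-stochastic empirical rows $\widehat P_k(\cdot|s,a)$ and rewards $\widehat r_k(s,a)$ (empirical averages over the non-reset transitions of a chain that, at each step, resets to $\rho$ with probability $1-\gamma$ and otherwise follows $P$ under a frozen exploratory behavior policy $\bar\pi^k$, unvisited entries being replaced by fixed values). Set $\widehat R_k(\pi,V)=(I-\gamma\widehat P_{\pi,k})V-\widehat r_{\pi,k}$ with $\widehat P_{\pi,k}(s,\cdot)=\sum_a\pi(a|s)\widehat P_k(\cdot|s,a)$, $\widehat r_{\pi,k}(s)=\sum_a\pi(a|s)\widehat r_k(s,a)$, and $\widehat{\mathcal L}_{\beta,k}(\pi,V,\lambda)=c^{\mathsf T}V+\langle\lambda,\widehat R_k(\pi,V)\rangle+\frac\beta2\|\widehat R_k(\pi,V)\|^2$. Updates: $\pi^{k+1}\in\arg\min_{\pi\in\Pi}\{\widehat{\mathcal L}_{\beta,k}(\pi,V^k,\lambda^k)+\frac1{2\eta_\pi}\|\pi-\pi^k\|^2\}$; $V^{k+1}=\arg\min_V\{\widehat{\mathcal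 L}_{\beta,k}(\pi^{k+1},V,\lambda^k)+\frac1{2\eta_V}\|V-V^k\|^2\}$; $\lambda^{k+1}=\lambda^k+\beta\widehat R_k(\pi^{k+1},V^{k+1})$, with $\beta,\eta_\pi,\eta_V>0$. *)

theory Defs
  imports "HOL-Probability.Probability"
begin

unbundle vec_syntax

type_synonym ('s, 'a) policy = "real ^ 'a ^ 's"

definition prob_simplex :: "(real ^ 'n::finite) set" where
  "prob_simplex = {p. (\<forall>i. 0 \<le> p $ i) \<and> (\<Sum>i\<in>UNIV. p $ i) = 1}"

definition policies :: "('s::finite, 'a::finite) policy set" where
  "policies = {\<pi>. \<forall>s. \<pi> $ s \<in> prob_simplex}"

definition pmf_vec :: "'s::finite pmf \<Rightarrow> real ^ 's" where
  "pmf_vec p = (\<chi> s. pmf p s)"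

definition normal_cone :: "'v::real_inner set \<Rightarrow> 'v \<Rightarrow> 'v set" where
  "normal_cone C x = {g. x \<in> C \<and> (\<forall>y\<in>C. inner g (y - x) \<le> 0)}"


section \<open>Bellman residual, values and occupancy measures\<close>

record ('s, 'a) mdp =
  kernel :: "'s \<Rightarrow> 'a \<Rightarrow> 's pmf"
  reward :: "'s \<Rightarrow> 'a \<Rightarrow> real"
  restart :: "'s pmf"
  discount :: real

definition is_mdp :: "('s, 'a) mdp \<Rightarrow> real \<Rightarrow> bool" where
  "is_mdp D Rmax \<longleftrightarrow> 0 < discount D \<and> discount D < 1 \<and> (\<forall>s a. \<bar>reward D s a\<bar> \<le> Rmax)"

text \<open>The next three definitions take an arbitrary transition array and reward array, so that they
  serve both the true model and the empirical ones.\<close>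

definition system_matrix ::
    "real \<Rightarrow> ('s \<Rightarrow> 'a \<Rightarrow> 's \<Rightarrow> real) \<Rightarrow> ('s::finite, 'a::finite) policy \<Rightarrow> real ^ 's ^ 's" where
  "system_matrix \<gamma> p \<pi> = mat 1 - \<gamma> *\<^sub>R (\<chi> s s'. \<Sum>a\<in>UNIV. \<pi> $ s $ a * p s a s')"

definition policy_reward :: "('s \<Rightarrow> 'a \<Rightarrow> real) \<Rightarrow> ('s::finite, 'a::finite) policy \<Rightarrow> real ^ 's" where
  "policy_reward r \<pi> = (\<chi> s. \<Sum>a\<in>UNIV. \<pi> $ s $ a * r s a)"

definition bellman_residual ::
    "real \<Rightarrow> ('s \<Rightarrow> 'a \<Rightarrow> 's \<Rightarrow> real) \<Rightarrow> ('s \<Rightarrow> 'a \<Rightarrow> real) \<Rightarrow>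
     ('s::finite, 'a::finite) policy \<Rightarrow> real ^ 's \<Rightarrow> real ^ 's" where
  "bellman_residual \<gamma> p r \<pi> V = system_matrix \<gamma> p \<pi> *v V - policy_reward r \<pi>"

definition M_mat :: "('s::finite, 'a::finite) mdp \<Rightarrow> ('s, 'a) policy \<Rightarrow> real ^ 's ^ 's" where
  "M_mat D \<pi> = system_matrix (discount D) (\<lambda>s a s'. pmf (kernel D s a) s') \<pi>"

definition residual ::
    "('s::finite, 'a::finite) mdp \<Rightarrow> ('s, 'a) policy \<Rightarrow> real ^ 's \<Rightarrow> real ^ 's" where
  "residual D \<pi> V =
     bellman_residual (discount D) (\<lambda>s a s'. pmf (kernel D s a) s') (reward D) \<pi> V"

definition value_vec :: "('s::finite, 'a::finite) mdp \<Rightarrow> ('s, 'a) policy \<Rightarrow> real ^ 's" where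
  "value_vec D \<pi> = matrix_inv (M_mat D \<pi>) *v policy_reward (reward D) \<pi>"

definition q_vec :: "('s::finite, 'a::finite) mdp \<Rightarrow> ('s, 'a) policy \<Rightarrow> 's \<Rightarrow> real ^ 'a" where
  "q_vec D \<pi> s = (\<chi> a. reward D s a
      + discount D * (\<Sum>s'\<in>UNIV. pmf (kernel D s a) s' * value_vec D \<pi> $ s'))"

definition performance ::
    "('s::finite, 'a::finite) mdp \<Rightarrow> 's pmf \<Rightarrow> ('s, 'a) policy \<Rightarrow> real" where
  "performance D \<nu> \<pi> = inner (pmf_vec \<nu>) (value_vec D \<pi>)"

definition occupancy ::
    "('s::finite, 'a::finite) mdp \<Rightarrow> 's pmf \<Rightarrow> ('s, 'a) policy \<Rightarrow> real ^ 's" where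
  "occupancy D \<mu> \<pi> =
     (1 - discount D) *\<^sub>R (matrix_inv (transpose (M_mat D \<pi>)) *v pmf_vec \<mu>)"

definition maximizes_performance ::
    "('s::finite, 'a::finite) mdp \<Rightarrow> 's pmf \<Rightarrow> ('s, 'a) policy \<Rightarrow> bool" where
  "maximizes_performance D \<nu> \<pi> \<longleftrightarrow>
     \<pi> \<in> policies \<and> (\<forall>\<pi>'\<in>policies. performance D \<nu> \<pi>' \<le> performance D \<nu> \<pi>)"


section \<open>Residuals and mismatch coefficients\<close>

text \<open>The library sets \<open>infdist x {} = 0\<close>, so \<open>kkt_residual\<close> (and \<open>bellman_stationarity\<close> below) are
  meaningful only for \<open>\<pi> \<in> policies\<close>, where the normal cone contains 0.\<close>

definition kkt_residual ::
    "('s::finite, 'a::finite) mdp \<Rightarrow> 's pmf \<Rightarrow> ('s, 'a) policy \<times> (real ^ 's) \<times> (real ^ 's) \<Rightarrow> real" where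
  "kkt_residual D \<mu> = (\<lambda>(\<pi>, V, \<Lambda>).
     (infdist 0 ((\<lambda>n. n + adjoint (frechet_derivative (\<lambda>p. residual D p V) (at \<pi>)) \<Lambda>)
                   ` normal_cone policies \<pi>))\<^sup>2
     + (norm (transpose (M_mat D \<pi>) *v \<Lambda> - pmf_vec \<mu>))\<^sup>2
     + (norm (residual D \<pi> V))\<^sup>2)"

definition bellman_stationarity ::
    "('s::finite, 'a::finite) mdp \<Rightarrow> ('s, 'a) policy \<Rightarrow> 's \<Rightarrow> real" where
  "bellman_stationarity D \<pi> s =
     infdist 0 ((\<lambda>n. - q_vec D \<pi> s + n) ` normal_cone prob_simplex (\<pi> $ s))"

definition improvement_gap ::
    "('s::finite, 'a::finite) mdp \<Rightarrow> ('s, 'a) policy \<Rightarrow> 's \<Rightarrow> real" where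
  "improvement_gap D \<pi> s = Max (range (\<lambda>a. q_vec D \<pi> s $ a)) - value_vec D \<pi> $ s"

text \<open>Norm of an entrywise ratio; \<open>0/0 = 0\<close> is already the library convention on the reals.\<close>

definition ratio_norm ::
    "(real ^ 's \<Rightarrow> real) \<Rightarrow> real ^ 's::finite \<Rightarrow> real ^ 's \<Rightarrow> ereal" where
  "ratio_norm N x y =
     (if \<exists>s. x $ s > 0 \<and> y $ s = 0 then \<infinity> else ereal (N (\<chi> s. x $ s / y $ s)))"

definition mismatch_2 ::
    "('s::finite, 'a::finite) mdp \<Rightarrow> ('s, 'a) policy \<Rightarrow> ('s, 'a) policy \<Rightarrow> 's pmf \<Rightarrow> 's pmf \<Rightarrow> ereal" where
  "mismatch_2 D \<pi>opt \<pi> \<nu> \<mu> = ratio_norm norm (occupancy D \<nu> \<pi>opt) (occupancy D \<mu> \<pi>)"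

definition mismatch_inf ::
    "('s::finite, 'a::finite) mdp \<Rightarrow> ('s, 'a) policy \<Rightarrow> ('s, 'a) policy \<Rightarrow> 's pmf \<Rightarrow> 's pmf \<Rightarrow> ereal" where
  "mismatch_inf D \<pi>opt \<pi> \<nu> \<mu> =
     ratio_norm infnorm (occupancy D \<nu> \<pi>opt) (\<chi> s. (occupancy D \<mu> \<pi> $ s)\<^sup>2)"


section \<open>Markovian sampling\<close>

datatype ('s, 'a) transition =
  Transition (src: 's) (act: 'a) (rew: real) (was_reset: bool) (dst: 's)

type_synonym ('s, 'a) batch = "('s, 'a) transition list"

text \<open>A history is the list of the batches drawn so far, oldest first. All iterates before
  iteration \<open>k\<close> are functions of the history of length \<open>k\<close>, so letting the behavior policy and the
  law of the first state of a batch depend on the history allows any dependence on the past,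
  including continuing the chain of the previous batch.
  \<open>kernel_fill\<close> and \<open>reward_fill\<close> replace unvisited entries.\<close>

record ('s, 'a) admm =
  beta :: real
  eta_pi :: real
  eta_V :: real
  init :: "('s::finite, 'a::finite) policy \<times> (real ^ 's) \<times> (real ^ 's)"
  kernel_fill :: "'s \<Rightarrow> 'a \<Rightarrow> 's pmf"
  reward_fill :: "'s \<Rightarrow> 'a \<Rightarrow> real"
  behavior :: "('s, 'a) batch list \<Rightarrow> 's \<Rightarrow> 'a pmf"
  first_state :: "('s, 'a) batch list \<Rightarrow> 's pmf"

text \<open>\<open>Exploratory\<close> means that the behavior policy gives every action positive probability.\<close>

definition is_admm :: "('s::finite, 'a::finite) admm \<Rightarrow> bool" where
  "is_admm S \<longleftrightarrow> beta S > 0 \<and> eta_pi S > 0 \<and> eta_V S > 0 \<and> fst (init S) \<in> policies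
     \<and> (\<forall>h s. set_pmf (behavior S h s) = UNIV)"

definition step_pmf ::
    "('s, 'a) mdp \<Rightarrow> ('s \<Rightarrow> 'a pmf) \<Rightarrow> 's \<Rightarrow> ('s, 'a) transition pmf" where
  "step_pmf D b s = do {
     a \<leftarrow> b s;
     z \<leftarrow> bernoulli_pmf (1 - discount D);
     s' \<leftarrow> (if z then restart D else kernel D s a);
     return_pmf (Transition s a (reward D s a) z s')
   }"

primrec batch_pmf ::
    "('s, 'a) mdp \<Rightarrow> ('s \<Rightarrow> 'a pmf) \<Rightarrow> nat \<Rightarrow> 's \<Rightarrow> ('s, 'a) batch pmf" where
  "batch_pmf D b 0 s = return_pmf []"
| "batch_pmf D b (Suc n) s = do {
     t \<leftarrow> step_pmf D b s;
     ts \<leftarrow> batch_pmf D b n (dst t);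
     return_pmf (t # ts)
   }"

primrec history_pmf ::
    "('s::finite, 'a::finite) mdp \<Rightarrow> ('s, 'a) admm \<Rightarrow> (nat \<Rightarrow> nat) \<Rightarrow> nat \<Rightarrow> ('s, 'a) batch list pmf" where
  "history_pmf D S m 0 = return_pmf []"
| "history_pmf D S m (Suc k) = do {
     h \<leftarrow> history_pmf D S m k;
     s \<leftarrow> first_state S h;
     b \<leftarrow> batch_pmf D (behavior S h) (m k) s;
     return_pmf (h @ [b])
   }"

definition visits :: "('s, 'a) batch \<Rightarrow> 's \<Rightarrow> 'a \<Rightarrow> ('s, 'a) batch" where
  "visits b s a = filter (\<lambda>t. src t = s \<and> act t = a \<and> \<not> was_reset t) b"

definition emp_kernel ::
    "('s::finite, 'a::finite) admm \<Rightarrow> ('s, 'a) batch \<Rightarrow> 's \<Rightarrow> 'a \<Rightarrow> 's \<Rightarrow> real" where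
  "emp_kernel S b s a s' =
     (if visits b s a = [] then pmf (kernel_fill S s a) s'
      else real (length (filter (\<lambda>t. dst t = s') (visits b s a))) / real (length (visits b s a)))"

definition emp_reward ::
    "('s::finite, 'a::finite) admm \<Rightarrow> ('s, 'a) batch \<Rightarrow> 's \<Rightarrow> 'a \<Rightarrow> real" where
  "emp_reward S b s a =
     (if visits b s a = [] then reward_fill S s a
      else (\<Sum>t\<leftarrow>visits b s a. rew t) / real (length (visits b s a)))"


section \<open>The proximal Bellman-ADMM iteration\<close>

definition emp_residual ::
    "('s::finite, 'a::finite) mdp \<Rightarrow> ('s, 'a) admm \<Rightarrow> ('s, 'a) batch \<Rightarrow>
     ('s, 'a) policy \<Rightarrow> real ^ 's \<Rightarrow> real ^ 's" where
  "emp_residual D S b = bellman_residual (discount D) (emp_kernel S b) (emp_reward S b)"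

text \<open>Empirical augmented Lagrangian with \<open>c = - \<mu>\<close>.\<close>

definition emp_lagrangian ::
    "('s::finite, 'a::finite) mdp \<Rightarrow> ('s, 'a) admm \<Rightarrow> 's pmf \<Rightarrow> ('s, 'a) batch \<Rightarrow>
     ('s, 'a) policy \<Rightarrow> real ^ 's \<Rightarrow> real ^ 's \<Rightarrow> real" where
  "emp_lagrangian D S \<mu> b \<pi> V \<Lambda> =
     inner (- pmf_vec \<mu>) V + inner \<Lambda> (emp_residual D S b \<pi> V)
     + beta S / 2 * (norm (emp_residual D S b \<pi> V))\<^sup>2"

text \<open>Both subproblems have strongly convex continuous objectives over closed convex sets, so the
  minimizers exist and are unique and \<open>arg_min_on\<close> involves no genuine choice.\<close>

definition admm_step ::
    "('s::finite, 'a::finite) mdp \<Rightarrow> ('s, 'a) admm \<Rightarrow> 's pmf \<Rightarrow>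
     ('s, 'a) policy \<times> (real ^ 's) \<times> (real ^ 's) \<Rightarrow> ('s, 'a) batch \<Rightarrow>
     ('s, 'a) policy \<times> (real ^ 's) \<times> (real ^ 's)" where
  "admm_step D S \<mu> = (\<lambda>(\<pi>, V, \<Lambda>) b.
     let \<pi>' = arg_min_on (\<lambda>p. emp_lagrangian D S \<mu> b p V \<Lambda> + 1 / (2 * eta_pi S) * (norm (p - \<pi>))\<^sup>2)
                policies;
         V' = arg_min_on (\<lambda>W. emp_lagrangian D S \<mu> b \<pi>' W \<Lambda> + 1 / (2 * eta_V S) * (norm (W - V))\<^sup>2)
                UNIV
     in (\<pi>', V', \<Lambda> + beta S *\<^sub>R emp_residual D S b \<pi>' V'))"

definition iterate ::
    "('s::finite, 'a::finite) mdp \<Rightarrow> ('s, 'a) admm \<Rightarrow> 's pmf \<Rightarrow> ('s, 'a) batch list \<Rightarrow> nat \<Rightarrow>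
     ('s, 'a) policy \<times> (real ^ 's) \<times> (real ^ 's)" where
  "iterate D S \<mu> h k = foldl (admm_step D S \<mu>) (init S) (take k h)"

text \<open>\<open>companion D S \<mu> h k\<close> is the companion iterate with index \<open>k + 1\<close>.\<close>

definition companion ::
    "('s::finite, 'a::finite) mdp \<Rightarrow> ('s, 'a) admm \<Rightarrow> 's pmf \<Rightarrow> ('s, 'a) batch list \<Rightarrow> nat \<Rightarrow>
     ('s, 'a) policy \<times> (real ^ 's) \<times> (real ^ 's)" where
  "companion D S \<mu> h k =
     (let (\<pi>, V, \<Lambda>) = iterate D S \<mu> h k;
          \<pi>' = fst (iterate D S \<mu> h (Suc k))
      in (\<pi>', V, \<Lambda> + beta S *\<^sub>R emp_residual D S (h ! k) \<pi>' V))"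

text \<open>Joint law of the companion iterate with index \<open>K + 1\<close>, where \<open>K\<close> is uniform on
  \<open>{0,\<dots>,T-1}\<close> and independent of the history; its first component is the output policy.\<close>

definition output_pmf ::
    "('s::finite, 'a::finite) mdp \<Rightarrow> ('s, 'a) admm \<Rightarrow> 's pmf \<Rightarrow> (nat \<Rightarrow> nat) \<Rightarrow> nat \<Rightarrow>
     (('s, 'a) policy \<times> (real ^ 's) \<times> (real ^ 's)) pmf" where
  "output_pmf D S \<mu> m T =
     map_pmf (\<lambda>(h, k). companion D S \<mu> h k)
       (pair_pmf (history_pmf D S m T) (pmf_of_set {0..<T}))"

definition expected_kkt ::
    "('s::finite, 'a::finite) mdp \<Rightarrow> ('s, 'a) admm \<Rightarrow> 's pmf \<Rightarrow> (nat \<Rightarrow> nat) \<Rightarrow> nat \<Rightarrow> real" where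
  "expected_kkt D S \<mu> m T = measure_pmf.expectation (output_pmf D S \<mu> m T) (kkt_residual D \<mu>)"

definition expected_gap ::
    "('s::finite, 'a::finite) mdp \<Rightarrow> ('s, 'a) admm \<Rightarrow> 's pmf \<Rightarrow> 's pmf \<Rightarrow> ('s, 'a) policy \<Rightarrow>
     (nat \<Rightarrow> nat) \<Rightarrow> nat \<Rightarrow> real" where
  "expected_gap D S \<mu> \<nu> \<pi>opt m T =
     measure_pmf.expectation (output_pmf D S \<mu> m T)
       (\<lambda>z. performance D \<nu> \<pi>opt - performance D \<nu> (fst z))"

definition output_policies ::
    "('s::finite, 'a::finite) mdp \<Rightarrow> ('s, 'a) admm \<Rightarrow> 's pmf \<Rightarrow> (nat \<Rightarrow> nat) \<Rightarrow> nat \<Rightarrow> ('s, 'a) policy set" where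
  "output_policies D S \<mu> m T = fst ` set_pmf (output_pmf D S \<mu> m T)"

definition finite_time_bound ::
    "('s::finite, 'a::finite) mdp \<Rightarrow> ('s, 'a) admm \<Rightarrow> 's pmf \<Rightarrow> real \<Rightarrow> real \<Rightarrow> (nat \<Rightarrow> nat) \<Rightarrow> nat \<Rightarrow> bool" where
  "finite_time_bound D S \<mu> A B m T \<longleftrightarrow>
     expected_kkt D S \<mu> m T \<le> A / real T + B / real T * (\<Sum>k<T. 1 / real (m k))"

end

(* Write M for M_pi, x = M^{-T} mu, e = M^T lambda - mu and let n in N_Pi(pi) attain the distance in G.
   Since D_pi R(pi,V)^T lambda has the rows -lambda(s) Q_V(s,.), and since e and R(pi,V) control
   lambda - x and V - V^pi through M^{-1}, each row n_s lies within O(sqrt G) of x(s) Q^pi(s,.) as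
   long as G <= 1.  For G > 1 the trivial bound on the performance gap suffices; this split is what
   tames the product of the two errors and the unbounded V and lambda.
   The performance difference identity writes the gap as the sum over s of
   x*(s) <Q^pi(s,.), pi*_s - pi_s>, where x* = M_{pi*}^{-T} nu.  For (i), replace x(s) Q^pi(s,.) by
   n_s, which pairs nonpositively with pi*_s - pi_s, at the price of the ratio x*(s)/x(s).  For (ii),
   n_s / x(s) is again a normal vector, so the statewise stationarity measure is O(sqrt G / x(s)) and
   enters squared.  Integration uses Jensen for the square root; the output law has finite support. *)

theory Submission
  imports Defs
begin

text \<open>As a simp rule this would turn \<open>transpose A *v x\<close> into
  \<open>x v* A\<close>; products with the transpose are to keep the shape in which the lemmas below
  state them.\<close>

declare transpose_matrix_vector [simp del]

section \<open>The true model in coordinates: transitions, residual and its policy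
  derivative\<close>

definition transition_prob ::
    "('s::finite, 'a::finite) mdp \<Rightarrow> ('s, 'a) policy \<Rightarrow> 's \<Rightarrow> 's \<Rightarrow> real" where
  "transition_prob D \<pi> s s' = (\<Sum>a\<in>UNIV. \<pi> $ s $ a * pmf (kernel D s a) s')"

text \<open>Action values at an arbitrary V: the residual G is evaluated at a V that need not be the
  value of the policy.\<close>

definition lookahead ::
    "('s::finite, 'a::finite) mdp \<Rightarrow> real ^ 's \<Rightarrow> 's \<Rightarrow> real ^ 'a" where
  "lookahead D V s = (\<chi> a. reward D s a
      + discount D * (\<Sum>s'\<in>UNIV. pmf (kernel D s a) s' * V $ s'))"

lemma q_vec_eq_lookahead: "q_vec D \<pi> s = lookahead D (value_vec D \<pi>) s"
  by (simp add: q_vec_def lookahead_def)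

lemma prob_simplex_iff:
  "p \<in> prob_simplex \<longleftrightarrow> (\<forall>i. 0 \<le> p $ i) \<and> (\<Sum>i\<in>UNIV. p $ i) = 1"
  by (simp add: prob_simplex_def)

lemma policiesD: "\<pi> \<in> policies \<Longrightarrow> \<pi> $ s \<in> prob_simplex"
  by (simp add: policies_def)

lemma norm_prob_simplex_le: "p \<in> prob_simplex \<Longrightarrow> norm p \<le> 1"
  using norm_le_l1_cart[of p] by (simp add: prob_simplex_iff)

lemma sum_pmf_UNIV [simp]: "(\<Sum>i\<in>UNIV. pmf p i) = 1" for p :: "'s::finite pmf"
  by (rule sum_pmf_eq_1) auto

lemma transition_prob_nonneg: "\<pi> \<in> policies \<Longrightarrow> 0 \<le> transition_prob D \<pi> s s'"
  unfolding transition_prob_def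
  by (intro sum_nonneg mult_nonneg_nonneg) (auto simp: policies_def prob_simplex_iff)

lemma sum_transition_prob:
  assumes "\<pi> \<in> policies" shows "(\<Sum>s'\<in>UNIV. transition_prob D \<pi> s s') = 1"
proof -
  have "(\<Sum>s'\<in>UNIV. transition_prob D \<pi> s s')
      = (\<Sum>a\<in>UNIV. \<Sum>s'\<in>UNIV. \<pi> $ s $ a * pmf (kernel D s a) s')"
    unfolding transition_prob_def by (rule sum.swap)
  also have "\<dots> = (\<Sum>a\<in>UNIV. \<pi> $ s $ a)"
    by (simp flip: sum_distrib_left)
  finally show ?thesis using policiesD[OF assms, of s] by (simp add: prob_simplex_iff)
qed

lemma M_mat_nth:
  "M_mat D \<pi> $ s $ s' = (if s = s' then 1 else 0) - discount D * transition_prob D \<pi> s s'"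
  by (simp add: M_mat_def system_matrix_def mat_def transition_prob_def)

lemma transpose_M_mat_mult_nth:
  "(transpose (M_mat D \<pi>) *v x) $ s' = x $ s' - discount D * (\<Sum>s\<in>UNIV. transition_prob D \<pi> s s' * x $ s)"
  by (simp add: matrix_vector_mult_def transpose_def M_mat_nth left_diff_distrib sum_subtractf
      if_distrib[of "\<lambda>c. c * _"] sum_distrib_left mult.assoc cong: if_cong)

lemma M_mat_mult_nth:
  "(M_mat D \<pi> *v x) $ s = x $ s - discount D * (\<Sum>s'\<in>UNIV. transition_prob D \<pi> s s' * x $ s')"
  by (simp add: matrix_vector_mult_def M_mat_nth left_diff_distrib sum_subtractf
      if_distrib[of "\<lambda>c. c * _"] sum_distrib_left mult.assoc cong: if_cong)

lemma residual_eq: "residual D \<pi> V = M_mat D \<pi> *v V - policy_reward (reward D) \<pi>"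
  by (simp add: residual_def bellman_residual_def M_mat_def)

text \<open>For fixed V, row s is affine in \<pi>_s alone, with slope
  \<open>- lookahead D V s\<close>. The policy derivative, the formula for values and the
  performance difference all start from this form.\<close>

lemma residual_nth: "residual D \<pi> V $ s = V $ s - inner (\<pi> $ s) (lookahead D V s)"
proof -
  have "(\<Sum>s'\<in>UNIV. transition_prob D \<pi> s s' * V $ s')
      = (\<Sum>s'\<in>UNIV. \<Sum>a\<in>UNIV. \<pi> $ s $ a * (pmf (kernel D s a) s' * V $ s'))"
    by (simp add: transition_prob_def sum_distrib_right mult.assoc)
  also have "\<dots> = (\<Sum>a\<in>UNIV. \<pi> $ s $ a * (\<Sum>s'\<in>UNIV. pmf (kernel D s a) s' * V $ s'))"
    by (subst sum.swap) (simp add: sum_distrib_left)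
  finally show ?thesis
    by (simp add: residual_eq M_mat_mult_nth policy_reward_def inner_vec_def lookahead_def
        algebra_simps sum.distrib sum_distrib_left)
qed

text \<open>An affine map has its linear part as derivative at every point, and the adjoint of that
  linear part can be read off state by state.\<close>

lemma adjoint_residual_derivative:
  fixes D :: "('s::finite, 'a::finite) mdp"
  shows "adjoint (frechet_derivative (\<lambda>p. residual D p V) (at \<pi>)) \<Lambda>
     = (\<chi> s. - \<Lambda> $ s *\<^sub>R lookahead D V s)"
proof -
  define f :: "('s, 'a) policy \<Rightarrow> real ^ 's"
    where "f = (\<lambda>h. - (\<chi> s. inner (h $ s) (lookahead D V s)))"
  have lin: "linear f"
    by (rule linearI) (simp_all add: f_def vec_eq_iff inner_add_left)
  have res: "(\<lambda>p. residual D p V) = (\<lambda>p. V + f p)"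
    by (simp add: fun_eq_iff vec_eq_iff residual_nth f_def)
  have "((\<lambda>p. residual D p V) has_derivative f) (at \<pi>)"
    unfolding res using lin by (auto intro!: derivative_eq_intros linear_imp_has_derivative)
  then have fd: "frechet_derivative (\<lambda>p. residual D p V) (at \<pi>) = f"
    by (metis frechet_derivative_at)
  have "adjoint f = (\<lambda>\<Lambda>. \<chi> s. - \<Lambda> $ s *\<^sub>R lookahead D V s)"
  proof (rule adjoint_unique, intro allI)
    fix x :: "('s, 'a) policy" and y :: "real ^ 's"
    show "inner (f x) y = inner x (\<chi> s. - y $ s *\<^sub>R lookahead D V s)"
      \<comment> \<open>The type instances expand only the sums over states and leave the inner
        products over actions intact.\<close>
      unfolding inner_vec_def[where 'a = real and 'b = 's] inner_vec_def[where 'a = "real ^ 'a"]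
      by (simp add: f_def mult.commute)
  qed
  then show ?thesis by (simp add: fd)
qed

section \<open>Matrix inverses, normal cones and ratio norms\<close>

lemma matrix_inv_mult_cancel:
  fixes A :: "real ^ 'n ^ 'n"
  assumes "invertible A" shows "A *v (matrix_inv A *v b) = b"
proof -
  have "A ** matrix_inv A = mat 1"
    unfolding matrix_inv_def
    by (rule someI2_ex) (use assms in \<open>auto simp: invertible_def\<close>)
  then show ?thesis by (simp add: matrix_vector_mul_assoc)
qed

text \<open>An intersection of closed halfspaces if x lies in C, and empty otherwise.\<close>

lemma closed_normal_cone: "closed (normal_cone C x)"
proof (cases "x \<in> C")
  case True
  then have "normal_cone C x = (\<Inter>y\<in>C. {g. inner (y - x) g \<le> 0})"
    by (auto simp: normal_cone_def inner_commute)
  then show ?thesis by (auto intro!: closed_halfspace_le)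
qed (simp add: normal_cone_def)

lemma zero_in_normal_cone: "x \<in> C \<Longrightarrow> 0 \<in> normal_cone C x"
  by (simp add: normal_cone_def)

lemma scaleR_in_normal_cone: "n \<in> normal_cone C x \<Longrightarrow> 0 \<le> c \<Longrightarrow> c *\<^sub>R n \<in> normal_cone C x"
  by (simp add: normal_cone_def mult_nonneg_nonpos)

text \<open>A nonempty closed set in a Euclidean space has a point nearest to 0. This replaces the
  distance in G by the norm of one concrete vector.\<close>

lemma infdist_translate_attained:
  fixes N :: "'v::euclidean_space set"
  assumes "closed N" "N \<noteq> {}"
  obtains n where "n \<in> N" "infdist 0 ((\<lambda>n. n + v) ` N) = norm (n + v)"
proof -
  have "closed ((\<lambda>n. n + v) ` N)"
    using closed_translation[OF assms(1), of v] by (simp add: add.commute)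
  then obtain y where "y \<in> (\<lambda>n. n + v) ` N" "infdist 0 ((\<lambda>n. n + v) ` N) = dist 0 y"
    using infdist_attains_inf[of "(\<lambda>n. n + v) ` N" 0] assms(2) by auto
  then show ?thesis using that by auto
qed

text \<open>The set \<open>policies\<close> is a product, so changing row s alone gives a competitor
  for which all other summands of the inner product vanish.\<close>

lemma normal_cone_policies_nth:
  fixes \<pi> :: "('s::finite, 'a::finite) policy"
  assumes "n \<in> normal_cone policies \<pi>"
  shows "n $ s \<in> normal_cone prob_simplex (\<pi> $ s)"
proof -
  have pi: "\<pi> \<in> policies" and le: "\<And>y. y \<in> policies \<Longrightarrow> inner n (y - \<pi>) \<le> 0"
    using assms by (auto simp: normal_cone_def)
  have "inner (n $ s) (p - \<pi> $ s) \<le> 0" if p: "p \<in> prob_simplex" for p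
  proof -
    define y where "y = (\<chi> t. if t = s then p else \<pi> $ t)"
    have "y \<in> policies" using p pi by (simp add: y_def policies_def)
    then have "(\<Sum>t\<in>UNIV. inner (n $ t) ((y - \<pi>) $ t)) \<le> 0"
      using le by (simp add: inner_vec_def[where 'a = "real ^ 'a"])
    also have "(\<Sum>t\<in>UNIV. inner (n $ t) ((y - \<pi>) $ t))
        = (\<Sum>t\<in>UNIV. if t = s then inner (n $ s) (p - \<pi> $ s) else 0)"
      by (rule sum.cong) (auto simp: y_def)
    finally show ?thesis by simp
  qed
  then show ?thesis using policiesD[OF pi] by (simp add: normal_cone_def)
qed

lemma kkt_residual_nonneg: "0 \<le> kkt_residual D \<mu> z"
  by (cases z) (simp add: kkt_residual_def)

text \<open>A finite bound excludes the infinite branch, and \<open>comp\<close> then passes from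
  the norm to single entries. The parameter \<open>N\<close> lets this serve both mismatch
  coefficients.\<close>

lemma ratio_norm_leD:
  assumes le: "ratio_norm N x y \<le> ereal c" and comp: "\<And>v i. \<bar>v $ i\<bar> \<le> N v"
    and nonneg: "\<And>s. 0 \<le> x $ s" and "x $ s \<noteq> 0"
  shows "y $ s \<noteq> 0" "x $ s / y $ s \<le> c"
proof -
  have no: "\<not> (\<exists>s. x $ s > 0 \<and> y $ s = 0)" using le by (auto simp: ratio_norm_def split: if_splits)
  then show "y $ s \<noteq> 0" using nonneg[of s] \<open>x $ s \<noteq> 0\<close> by force
  have "N (\<chi> s. x $ s / y $ s) \<le> c" using le no by (simp add: ratio_norm_def)
  then show "x $ s / y $ s \<le> c" using comp[of "\<chi> s. x $ s / y $ s" s] abs_ge_self[of "x $ s / y $ s"] by simp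
qed

section \<open>Discounted MDPs: inverting M_\<pi> and its transpose, visitation measures\<close>

locale discounted_mdp =
  fixes D :: "('s::finite, 'a::finite) mdp" and Rmax :: real
  assumes is_mdp: "is_mdp D Rmax"
begin

abbreviation \<gamma> where "\<gamma> \<equiv> discount D"
text \<open>The sum of the geometric series in \<gamma>. It bounds the inverse of M_\<pi> in the sup
  norm and that of its transpose in the l1 norm.\<close>

abbreviation \<kappa> where "\<kappa> \<equiv> 1 / (1 - \<gamma>)"

lemma discount_bounds: "0 < \<gamma>" "\<gamma> < 1" and reward_bound: "\<bar>reward D s a\<bar> \<le> Rmax"
  using is_mdp by (auto simp: is_mdp_def)

lemma Rmax_nonneg: "0 \<le> Rmax"
  using reward_bound[of undefined undefined] by linarith

lemma \<kappa>_ge_1: "1 \<le> \<kappa>" and \<kappa>_eq: "1 + \<gamma> * \<kappa> = \<kappa>"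
  using discount_bounds by (auto simp: field_simps)

text \<open>Write x = M^T x + \<gamma> P^T x. Since P_\<pi> is nonnegative with unit row sums, P^T
  does not increase the l1 norm, and the last term can be absorbed on the left.\<close>

lemma transpose_M_mat_l1_bound:
  assumes "\<pi> \<in> policies"
  shows "(\<Sum>s\<in>UNIV. \<bar>x $ s\<bar>) \<le> \<kappa> * (\<Sum>s\<in>UNIV. \<bar>(transpose (M_mat D \<pi>) *v x) $ s\<bar>)"
proof -
  let ?b = "transpose (M_mat D \<pi>) *v x"
  have "\<bar>x $ s'\<bar> \<le> \<bar>?b $ s'\<bar> + \<gamma> * (\<Sum>s\<in>UNIV. transition_prob D \<pi> s s' * \<bar>x $ s\<bar>)" for s'
  proof -
    have "\<bar>\<Sum>s\<in>UNIV. transition_prob D \<pi> s s' * x $ s\<bar>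
        \<le> (\<Sum>s\<in>UNIV. transition_prob D \<pi> s s' * \<bar>x $ s\<bar>)"
      using transition_prob_nonneg[OF assms, of D]
      by (intro order_trans[OF sum_abs]) (simp add: abs_mult)
    then have "\<gamma> * \<bar>\<Sum>s\<in>UNIV. transition_prob D \<pi> s s' * x $ s\<bar>
        \<le> \<gamma> * (\<Sum>s\<in>UNIV. transition_prob D \<pi> s s' * \<bar>x $ s\<bar>)"
      using discount_bounds by simp
    moreover have "x $ s' = ?b $ s' + \<gamma> * (\<Sum>s\<in>UNIV. transition_prob D \<pi> s s' * x $ s)"
      by (simp add: transpose_M_mat_mult_nth)
    then have "\<bar>x $ s'\<bar> \<le> \<bar>?b $ s'\<bar> + \<bar>\<gamma> * (\<Sum>s\<in>UNIV. transition_prob D \<pi> s s' * x $ s)\<bar>"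
      by (metis abs_triangle_ineq)
    moreover have "\<bar>\<gamma> * (\<Sum>s\<in>UNIV. transition_prob D \<pi> s s' * x $ s)\<bar>
        = \<gamma> * \<bar>\<Sum>s\<in>UNIV. transition_prob D \<pi> s s' * x $ s\<bar>"
      using discount_bounds by (simp add: abs_mult)
    ultimately show ?thesis by linarith
  qed
  then have "(\<Sum>s'\<in>UNIV. \<bar>x $ s'\<bar>)
      \<le> (\<Sum>s'\<in>UNIV. \<bar>?b $ s'\<bar> + \<gamma> * (\<Sum>s\<in>UNIV. transition_prob D \<pi> s s' * \<bar>x $ s\<bar>))"
    by (rule sum_mono)
  also have "\<dots> = (\<Sum>s'\<in>UNIV. \<bar>?b $ s'\<bar>)
      + \<gamma> * (\<Sum>s'\<in>UNIV. \<Sum>s\<in>UNIV. transition_prob D \<pi> s s' * \<bar>x $ s\<bar>)"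
    by (simp add: sum.distrib sum_distrib_left)
  also have "(\<Sum>s'\<in>UNIV. \<Sum>s\<in>UNIV. transition_prob D \<pi> s s' * \<bar>x $ s\<bar>) = (\<Sum>s\<in>UNIV. \<bar>x $ s\<bar>)"
    by (subst sum.swap) (simp add: sum_transition_prob[OF assms] flip: sum_distrib_right)
  finally have "(1 - \<gamma>) * (\<Sum>s\<in>UNIV. \<bar>x $ s\<bar>) \<le> (\<Sum>s\<in>UNIV. \<bar>?b $ s\<bar>)"
    by (simp add: left_diff_distrib)
  then show ?thesis using discount_bounds by (simp add: pos_le_divide_eq mult.commute)
qed

text \<open>The l1 bound leaves only 0 in the kernel.\<close>

lemma invertible_transpose_M_mat:
  assumes "\<pi> \<in> policies" shows "invertible (transpose (M_mat D \<pi>))"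
proof -
  have "x = 0" if "transpose (M_mat D \<pi>) *v x = 0" for x
  proof -
    have "(\<Sum>s\<in>UNIV. \<bar>x $ s\<bar>) \<le> 0"
      using transpose_M_mat_l1_bound[OF assms, of x] that by simp
    then have "(\<Sum>s\<in>UNIV. \<bar>x $ s\<bar>) = 0" by (simp add: antisym sum_nonneg)
    then show ?thesis by (simp add: sum_nonneg_eq_0_iff vec_eq_iff)
  qed
  then show ?thesis
    by (simp add: invertible_left_inverse matrix_left_invertible_ker)
qed

lemma invertible_M_mat: "\<pi> \<in> policies \<Longrightarrow> invertible (M_mat D \<pi>)"
  using transpose_invertible[OF invertible_transpose_M_mat] by simp

lemma M_mat_value_vec:
  "\<pi> \<in> policies \<Longrightarrow> M_mat D \<pi> *v value_vec D \<pi> = policy_reward (reward D) \<pi>"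
  by (simp add: value_vec_def matrix_inv_mult_cancel invertible_M_mat)

lemma value_vec_nth:
  assumes "\<pi> \<in> policies" shows "value_vec D \<pi> $ s = inner (\<pi> $ s) (q_vec D \<pi> s)"
  using residual_nth[of D \<pi> "value_vec D \<pi>" s] M_mat_value_vec[OF assms]
  by (simp add: residual_eq q_vec_eq_lookahead)

text \<open>The occupancy without its factor 1 - \<gamma>. A small second term of G ties the
  multiplier to this vector for \<open>p\<close> = \<mu>.\<close>

definition visitation :: "'s pmf \<Rightarrow> ('s, 'a) policy \<Rightarrow> real ^ 's" where
  "visitation p \<pi> = matrix_inv (transpose (M_mat D \<pi>)) *v pmf_vec p"

lemma occupancy_eq: "occupancy D p \<pi> $ s = (1 - \<gamma>) * visitation p \<pi> $ s"
  by (simp add: occupancy_def visitation_def)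

lemma transpose_M_mat_visitation:
  "\<pi> \<in> policies \<Longrightarrow> transpose (M_mat D \<pi>) *v visitation p \<pi> = pmf_vec p"
  by (simp add: visitation_def matrix_inv_mult_cancel invertible_transpose_M_mat)

text \<open>The source \<open>pmf_vec p\<close> is nonnegative, so the negative part y satisfies y
  \<le> \<gamma> P^T y entrywise. Summing over states bounds the mass of y by \<gamma> times itself,
  which forces y = 0.\<close>

lemma visitation_nonneg:
  assumes "\<pi> \<in> policies" shows "0 \<le> visitation p \<pi> $ s"
proof -
  let ?x = "visitation p \<pi>"
  define y where "y s = max 0 (- ?x $ s)" for s
  have y0: "0 \<le> y s" and xy: "- ?x $ s \<le> y s" for s by (auto simp: y_def)
  have "y s' \<le> \<gamma> * (\<Sum>s\<in>UNIV. transition_prob D \<pi> s s' * y s)" for s'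
  proof -
    have "?x $ s' = pmf p s' + \<gamma> * (\<Sum>s\<in>UNIV. transition_prob D \<pi> s s' * ?x $ s)"
      using transpose_M_mat_mult_nth[of D \<pi> ?x s'] transpose_M_mat_visitation[OF assms, of p]
      by (simp add: pmf_vec_def)
    moreover have "(\<Sum>s\<in>UNIV. transition_prob D \<pi> s s' * - ?x $ s) \<le> (\<Sum>s\<in>UNIV. transition_prob D \<pi> s s' * y s)"
      by (intro sum_mono mult_left_mono xy transition_prob_nonneg[OF assms])
    then have "- (\<Sum>s\<in>UNIV. transition_prob D \<pi> s s' * ?x $ s) \<le> (\<Sum>s\<in>UNIV. transition_prob D \<pi> s s' * y s)"
      by (simp add: sum_negf)
    then have "\<gamma> * - (\<Sum>s\<in>UNIV. transition_prob D \<pi> s s' * ?x $ s) \<le> \<gamma> * (\<Sum>s\<in>UNIV. transition_prob D \<pi> s s' * y s)"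
      using discount_bounds by (intro mult_left_mono) auto
    moreover have "0 \<le> \<gamma> * (\<Sum>s\<in>UNIV. transition_prob D \<pi> s s' * y s)"
      using discount_bounds
      by (intro mult_nonneg_nonneg sum_nonneg y0 transition_prob_nonneg[OF assms]) auto
    ultimately show ?thesis
      unfolding y_def[of s'] using pmf_nonneg[of p s'] by linarith
  qed
  then have "(\<Sum>s'\<in>UNIV. y s') \<le> (\<Sum>s'\<in>UNIV. \<gamma> * (\<Sum>s\<in>UNIV. transition_prob D \<pi> s s' * y s))"
    by (rule sum_mono)
  also have "\<dots> = \<gamma> * (\<Sum>s'\<in>UNIV. \<Sum>s\<in>UNIV. transition_prob D \<pi> s s' * y s)"
    by (simp only: sum_distrib_left)
  also have "(\<Sum>s'\<in>UNIV. \<Sum>s\<in>UNIV. transition_prob D \<pi> s s' * y s) = (\<Sum>s\<in>UNIV. y s)"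
    by (subst sum.swap) (simp add: sum_transition_prob[OF assms] flip: sum_distrib_right)
  finally have "(1 - \<gamma>) * (\<Sum>s\<in>UNIV. y s) \<le> 0" by (simp add: algebra_simps)
  then have "(\<Sum>s\<in>UNIV. y s) \<le> 0" using discount_bounds by (simp add: mult_le_0_iff)
  moreover have "y s \<le> (\<Sum>s\<in>UNIV. y s)" by (rule member_le_sum) (auto simp: y0)
  ultimately show ?thesis using xy[of s] by linarith
qed

lemma abs_nth_le_of_transpose_M_mat:
  assumes "\<pi> \<in> policies"
  shows "\<bar>x $ s\<bar> \<le> \<kappa> * (\<Sum>s\<in>UNIV. \<bar>(transpose (M_mat D \<pi>) *v x) $ s\<bar>)"
proof -
  have "\<bar>x $ s\<bar> \<le> (\<Sum>s\<in>UNIV. \<bar>x $ s\<bar>)" by (rule member_le_sum) auto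
  then show ?thesis using transpose_M_mat_l1_bound[OF assms, of x] by linarith
qed

lemma visitation_le:
  assumes "\<pi> \<in> policies" shows "visitation p \<pi> $ s \<le> \<kappa>"
  using abs_nth_le_of_transpose_M_mat[OF assms, of "visitation p \<pi>" s]
  by (simp add: transpose_M_mat_visitation[OF assms] pmf_vec_def)

text \<open>M_\<pi> is moved across the inner product. Applied to values this gives the performance
  difference; with a point mass for \<open>p\<close> it isolates a single entry of V.\<close>

lemma inner_pmf_vec_visitation:
  assumes "\<pi> \<in> policies"
  shows "inner (pmf_vec p) V = inner (visitation p \<pi>) (M_mat D \<pi> *v V)"
  using transpose_M_mat_visitation[OF assms, of p]
  by (metis dot_lmul_matrix transpose_matrix_vector)

text \<open>The sup-norm bound is dual to the l1 bound: \<open>V $ s\<close> is the inner product of \<open>M V\<close> with the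
  visitation measure started at \<open>s\<close>, whose total mass is at most \<open>\<kappa>\<close>.\<close>

lemma abs_nth_le_of_M_mat:
  assumes pi: "\<pi> \<in> policies" and b: "\<And>s. \<bar>(M_mat D \<pi> *v V) $ s\<bar> \<le> b"
  shows "\<bar>V $ s\<bar> \<le> \<kappa> * b"
proof -
  let ?x = "visitation (return_pmf s) \<pi>"
  have b0: "0 \<le> b" using b[of undefined] by linarith
  have "pmf_vec (return_pmf s) = axis s 1"
    by (simp add: pmf_vec_def axis_def vec_eq_iff indicator_def)
  then have "V $ s = inner ?x (M_mat D \<pi> *v V)"
    using inner_pmf_vec_visitation[OF pi, of "return_pmf s" V] by (simp add: inner_axis')
  then have "\<bar>V $ s\<bar> \<le> (\<Sum>t\<in>UNIV. \<bar>?x $ t\<bar> * b)"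
    unfolding inner_vec_def
    by (auto intro!: order_trans[OF sum_abs] sum_mono mult_left_mono b simp: abs_mult)
  also have "\<dots> = (\<Sum>t\<in>UNIV. \<bar>?x $ t\<bar>) * b" by (simp add: sum_distrib_right)
  also have "(\<Sum>t\<in>UNIV. \<bar>?x $ t\<bar>) \<le> \<kappa>"
    using transpose_M_mat_l1_bound[OF pi, of ?x]
    unfolding transpose_M_mat_visitation[OF pi] by (simp add: pmf_vec_def del: pmf_return)
  finally show ?thesis using b0 by (simp add: mult_right_mono)
qed

section \<open>Bounds on values and the performance difference identity\<close>

lemma abs_sum_prob_mult_le:
  fixes p V :: "'n::finite \<Rightarrow> real"
  assumes "\<And>i. 0 \<le> p i" "sum p UNIV = 1" "\<And>i. \<bar>V i\<bar> \<le> b"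
  shows "\<bar>\<Sum>i\<in>UNIV. p i * V i\<bar> \<le> b"
proof -
  have "\<bar>\<Sum>i\<in>UNIV. p i * V i\<bar> \<le> (\<Sum>i\<in>UNIV. p i * b)"
    by (auto intro!: order_trans[OF sum_abs] sum_mono mult_left_mono assms simp: abs_mult assms(1))
  then show ?thesis by (simp add: assms(2) flip: sum_distrib_right)
qed

lemma abs_value_vec_le:
  assumes pi: "\<pi> \<in> policies" shows "\<bar>value_vec D \<pi> $ s\<bar> \<le> \<kappa> * Rmax"
proof (rule abs_nth_le_of_M_mat[OF pi])
  fix s
  show "\<bar>(M_mat D \<pi> *v value_vec D \<pi>) $ s\<bar> \<le> Rmax"
    unfolding M_mat_value_vec[OF pi] policy_reward_def
    using policiesD[OF pi, of s] reward_bound[of s]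
    by (simp add: prob_simplex_iff abs_sum_prob_mult_le)
qed

lemma abs_performance_le: "\<pi> \<in> policies \<Longrightarrow> \<bar>performance D \<nu> \<pi>\<bar> \<le> \<kappa> * Rmax"
  unfolding performance_def inner_vec_def
  using abs_sum_prob_mult_le[of "pmf \<nu>" "\<lambda>s. value_vec D \<pi> $ s"] abs_value_vec_le[of \<pi>]
  by (simp add: pmf_vec_def)

text \<open>The direct estimate is Rmax + \<gamma> \<kappa> Rmax, and 1 + \<gamma> \<kappa> =
  \<kappa> turns it into the bound known for state values.\<close>

lemma abs_q_vec_le:
  assumes pi: "\<pi> \<in> policies" shows "\<bar>q_vec D \<pi> s $ a\<bar> \<le> \<kappa> * Rmax"
proof -
  let ?S = "\<Sum>s'\<in>UNIV. pmf (kernel D s a) s' * value_vec D \<pi> $ s'"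
  have "\<bar>?S\<bar> \<le> \<kappa> * Rmax"
    using abs_value_vec_le[OF pi] by (intro abs_sum_prob_mult_le) auto
  then have "\<gamma> * \<bar>?S\<bar> \<le> \<gamma> * (\<kappa> * Rmax)"
    using discount_bounds by (intro mult_left_mono) auto
  moreover have "\<bar>\<gamma> * ?S\<bar> = \<gamma> * \<bar>?S\<bar>" using discount_bounds by (simp add: abs_mult)
  moreover have "q_vec D \<pi> s $ a = reward D s a + \<gamma> * ?S" by (simp add: q_vec_def)
  ultimately have "\<bar>q_vec D \<pi> s $ a\<bar> \<le> Rmax + \<gamma> * (\<kappa> * Rmax)"
    using reward_bound[of s a] by linarith
  also have "\<dots> = (1 + \<gamma> * \<kappa>) * Rmax" by (simp add: algebra_simps)
  finally show ?thesis by (simp only: \<kappa>_eq)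
qed

text \<open>The matrix of \<pi>' sends the value of \<pi>' to its reward, so it sends the difference
  of the two values to minus the residual of \<pi>' at the value of \<pi>. Pairing with the
  visitation measure of \<pi>' gives the sum.\<close>

lemma performance_difference:
  assumes "\<pi>' \<in> policies" "\<pi> \<in> policies"
  shows "performance D \<nu> \<pi>' - performance D \<nu> \<pi>
    = (\<Sum>s\<in>UNIV. visitation \<nu> \<pi>' $ s * (inner (\<pi>' $ s) (q_vec D \<pi> s) - value_vec D \<pi> $ s))"
proof -
  have "performance D \<nu> \<pi>' - performance D \<nu> \<pi>
      = inner (pmf_vec \<nu>) (value_vec D \<pi>') - inner (pmf_vec \<nu>) (value_vec D \<pi>)"
    by (simp add: performance_def)
  also have "\<dots> = inner (visitation \<nu> \<pi>') (M_mat D \<pi>' *v value_vec D \<pi>' - M_mat D \<pi>' *v value_vec D \<pi>)"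
    unfolding inner_pmf_vec_visitation[OF assms(1)] by (simp add: inner_diff_right)
  also have "\<dots> = inner (visitation \<nu> \<pi>') (- residual D \<pi>' (value_vec D \<pi>))"
    by (simp add: M_mat_value_vec[OF assms(1)] residual_eq)
  finally show ?thesis
    by (simp add: inner_vec_def[where 'a = real] residual_nth q_vec_eq_lookahead)
qed

section \<open>From a small KKT residual to weighted action values that are nearly normal\<close>

definition cone_error_const :: real where
  "cone_error_const = real CARD('a) *
      (1 + (\<kappa> + \<kappa> * real CARD('s)) * \<kappa> + \<kappa> * real CARD('s) * (\<kappa> * Rmax))"

lemma cone_error_const_nonneg: "0 \<le> cone_error_const"
  unfolding cone_error_const_def using discount_bounds Rmax_nonneg
  by (intro mult_nonneg_nonneg add_nonneg_nonneg) auto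

text \<open>With Q_V for \<open>lookahead D V\<close>, J for the adjoint term and x for the
  visitation measure, n - x Q = (n + J) + \<Lambda> (Q_V - Q) + (\<Lambda> - x) Q in every row. The
  three terms of G control n + J, \<Lambda> - x and Q_V - Q in this order.\<close>

lemma kkt_residual_imp_near_normal:
  assumes pi: "\<pi> \<in> policies" and le1: "kkt_residual D \<mu> (\<pi>, V, \<Lambda>) \<le> 1"
  obtains n where "\<And>s. n s \<in> normal_cone prob_simplex (\<pi> $ s)"
    "\<And>s. norm (n s - visitation \<mu> \<pi> $ s *\<^sub>R q_vec D \<pi> s) \<le> cone_error_const * sqrt (kkt_residual D \<mu> (\<pi>, V, \<Lambda>))"
proof -
  define g where "g = sqrt (kkt_residual D \<mu> (\<pi>, V, \<Lambda>))"
  define x where "x = visitation \<mu> \<pi>"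
  define e where "e = transpose (M_mat D \<pi>) *v \<Lambda> - pmf_vec \<mu>"
  define J where "J = (\<chi> s. - \<Lambda> $ s *\<^sub>R lookahead D V s)"
  obtain n where n: "n \<in> normal_cone policies \<pi>"
    and nd: "infdist 0 ((\<lambda>n. n + J) ` normal_cone policies \<pi>) = norm (n + J)"
    using infdist_translate_attained[OF closed_normal_cone, of policies \<pi> J] zero_in_normal_cone[OF pi]
    by blast
  have G: "kkt_residual D \<mu> (\<pi>, V, \<Lambda>) = (norm (n + J))\<^sup>2 + (norm e)\<^sup>2 + (norm (residual D \<pi> V))\<^sup>2"
    unfolding kkt_residual_def prod.case adjoint_residual_derivative J_def[symmetric] nd e_def ..
  have w_le: "norm (n + J) \<le> g" and e_le: "norm e \<le> g" and r_le: "norm (residual D \<pi> V) \<le> g"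
    unfolding g_def G by (auto intro!: real_le_rsqrt)
  have g0: "0 \<le> g" and g1: "g \<le> 1" using le1 by (auto simp: g_def G)
  have k0: "0 \<le> \<kappa>" using \<kappa>_ge_1 by linarith
  have x0: "0 \<le> x $ s" and xk: "x $ s \<le> \<kappa>" for s
    using visitation_nonneg[OF pi] visitation_le[OF pi] by (auto simp: x_def)
  have Lx: "\<bar>\<Lambda> $ s - x $ s\<bar> \<le> \<kappa> * real CARD('s) * g" for s
  proof -
    have "transpose (M_mat D \<pi>) *v (\<Lambda> - x) = e"
      by (simp add: matrix_vector_mult_diff_distrib e_def x_def transpose_M_mat_visitation[OF pi])
    then have "\<bar>(\<Lambda> - x) $ s\<bar> \<le> \<kappa> * (\<Sum>s\<in>UNIV. \<bar>e $ s\<bar>)"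
      using abs_nth_le_of_transpose_M_mat[OF pi, of "\<Lambda> - x" s] by simp
    \<comment> \<open>Each entry of \<open>e\<close> is at most its norm; summing over the states
      produces the factor \<open>real CARD('s)\<close>.\<close>
    also have "\<dots> \<le> \<kappa> * (\<Sum>s\<in>(UNIV :: 's set). g)"
      using component_le_norm_cart[of e] e_le k0
      by (intro mult_left_mono sum_mono) (auto intro: order_trans)
    finally show ?thesis by simp
  qed
  \<comment> \<open>Here G \<le> 1 enters: a bound on the multiplier that is free of
    \<open>g\<close> keeps its product with the value error linear in \<open>g\<close>.\<close>
  have L: "\<bar>\<Lambda> $ s\<bar> \<le> \<kappa> + \<kappa> * real CARD('s)" for s
  proof -
    have "\<kappa> * real CARD('s) * g \<le> \<kappa> * real CARD('s)"
      using g1 k0 by (intro mult_left_le) auto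
    then show ?thesis using Lx[of s] x0[of s] xk[of s] by linarith
  qed
  have V: "\<bar>V $ s - value_vec D \<pi> $ s\<bar> \<le> \<kappa> * g" for s
  proof -
    have "\<bar>(V - value_vec D \<pi>) $ s\<bar> \<le> \<kappa> * g"
    proof (rule abs_nth_le_of_M_mat[OF pi])
      fix t
      have "M_mat D \<pi> *v (V - value_vec D \<pi>) = residual D \<pi> V"
        by (simp add: matrix_vector_mult_diff_distrib M_mat_value_vec[OF pi] residual_eq)
      then show "\<bar>(M_mat D \<pi> *v (V - value_vec D \<pi>)) $ t\<bar> \<le> g"
        using component_le_norm_cart[of "residual D \<pi> V" t] r_le by simp
    qed
    then show ?thesis by simp
  qed
  have Q: "\<bar>lookahead D V s $ a - q_vec D \<pi> s $ a\<bar> \<le> \<kappa> * g" for s a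
  proof -
    let ?S = "\<Sum>s'\<in>UNIV. pmf (kernel D s a) s' * (V $ s' - value_vec D \<pi> $ s')"
    have "lookahead D V s $ a - q_vec D \<pi> s $ a = \<gamma> * ?S"
      by (simp add: lookahead_def q_vec_def right_diff_distrib sum_subtractf)
    moreover have "\<bar>?S\<bar> \<le> \<kappa> * g" using V by (intro abs_sum_prob_mult_le) auto
    moreover have "\<gamma> * \<bar>?S\<bar> \<le> \<bar>?S\<bar>" using discount_bounds by (intro mult_left_le_one_le) auto
    ultimately show ?thesis using discount_bounds by (simp add: abs_mult)
  qed
  have "norm (n $ s - x $ s *\<^sub>R q_vec D \<pi> s) \<le> cone_error_const * g" for s
  proof -
    have "\<bar>(n $ s - x $ s *\<^sub>R q_vec D \<pi> s) $ a\<bar>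
        \<le> g + (\<kappa> + \<kappa> * real CARD('s)) * (\<kappa> * g) + \<kappa> * real CARD('s) * g * (\<kappa> * Rmax)" for a
    proof -
      have "(n $ s - x $ s *\<^sub>R q_vec D \<pi> s) $ a = (n + J) $ s $ a
          + \<Lambda> $ s * (lookahead D V s $ a - q_vec D \<pi> s $ a) + (\<Lambda> $ s - x $ s) * q_vec D \<pi> s $ a"
        by (simp add: J_def algebra_simps)
      moreover have "\<bar>(n + J) $ s $ a\<bar> \<le> g"
        using component_le_norm_cart[of "(n + J) $ s" a] Finite_Cartesian_Product.norm_nth_le[of "n + J" s] w_le by linarith
      moreover have "\<bar>\<Lambda> $ s * (lookahead D V s $ a - q_vec D \<pi> s $ a)\<bar>
          \<le> (\<kappa> + \<kappa> * real CARD('s)) * (\<kappa> * g)"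
        unfolding abs_mult using k0 by (intro mult_mono L Q) auto
      moreover have "\<bar>(\<Lambda> $ s - x $ s) * q_vec D \<pi> s $ a\<bar> \<le> \<kappa> * real CARD('s) * g * (\<kappa> * Rmax)"
        unfolding abs_mult using k0 g0 by (intro mult_mono Lx abs_q_vec_le[OF pi]) auto
      ultimately show ?thesis by linarith
    qed
    \<comment> \<open>The Euclidean norm is dominated by the l1 norm, whence the factor
      \<open>real CARD('a)\<close> in the constant.\<close>
    then have "(\<Sum>a\<in>UNIV. \<bar>(n $ s - x $ s *\<^sub>R q_vec D \<pi> s) $ a\<bar>)
        \<le> (\<Sum>a\<in>(UNIV :: 'a set). g + (\<kappa> + \<kappa> * real CARD('s)) * (\<kappa> * g)
              + \<kappa> * real CARD('s) * g * (\<kappa> * Rmax))"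
      by (rule sum_mono)
    also have "\<dots> = cone_error_const * g" by (simp add: cone_error_const_def algebra_simps)
    finally show ?thesis using norm_le_l1_cart order_trans by blast
  qed
  then show ?thesis
    using that[of "\<lambda>s. n $ s"] normal_cone_policies_nth[OF n] by (simp add: x_def g_def)
qed

section \<open>Performance gap of a single policy in terms of its KKT residual\<close>

lemma performance_gap_le_const:
  assumes "\<pi>' \<in> policies" "\<pi> \<in> policies"
  shows "performance D \<nu> \<pi>' - performance D \<nu> \<pi> \<le> 2 * \<kappa> * Rmax"
  using abs_performance_le[OF assms(1), of \<nu>] abs_performance_le[OF assms(2), of \<nu>] by linarith

lemma occupancy_nonneg: "\<pi> \<in> policies \<Longrightarrow> 0 \<le> occupancy D p \<pi> $ s"
  using visitation_nonneg[of \<pi> p s] discount_bounds by (simp add: occupancy_eq)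

text \<open>The constant adds the two regimes: \<open>?c1\<close> is the trivial bound for G > 1,
  \<open>?c2\<close> the estimate for G \<le> 1. Both are nonnegative, so the sum serves in either
  case.\<close>

lemma performance_gap_le_sqrt_kkt:
  assumes pi': "\<pi>' \<in> policies" and pi: "\<pi> \<in> policies"
    and mis: "mismatch_2 D \<pi>' \<pi> \<nu> \<mu> \<le> ereal c"
  shows "performance D \<nu> \<pi>' - performance D \<nu> \<pi>
    \<le> (2 * \<kappa> * Rmax + real CARD('s) * (\<bar>c\<bar> * (2 * cone_error_const))) * sqrt (kkt_residual D \<mu> (\<pi>, V, \<Lambda>))"
    (is "?gap \<le> (?c1 + ?c2) * ?g")
proof -
  have c1: "0 \<le> ?c1" using discount_bounds Rmax_nonneg by simp
  have c2: "0 \<le> ?c2" using cone_error_const_nonneg by simp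
  show ?thesis
  proof (cases "kkt_residual D \<mu> (\<pi>, V, \<Lambda>) \<le> 1")
    case False
    then have "1 \<le> ?g" by simp
    then have "?c1 \<le> (?c1 + ?c2) * ?g" using c1 c2 mult_mono[of ?c1 "?c1 + ?c2" 1 ?g] by simp
    then show ?thesis using performance_gap_le_const[OF pi' pi, of \<nu>] by linarith
  next
    case True
    obtain n where n: "\<And>s. n s \<in> normal_cone prob_simplex (\<pi> $ s)"
      and err: "\<And>s. norm (n s - visitation \<mu> \<pi> $ s *\<^sub>R q_vec D \<pi> s) \<le> cone_error_const * ?g"
      using kkt_residual_imp_near_normal[OF pi True] by blast
    have "visitation \<nu> \<pi>' $ s * (inner (\<pi>' $ s) (q_vec D \<pi> s) - value_vec D \<pi> $ s)
        \<le> \<bar>c\<bar> * (2 * cone_error_const * ?g)" for s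
    proof (cases "occupancy D \<nu> \<pi>' $ s = 0")
      case True
      \<comment> \<open>As 1 - \<gamma> is nonzero, the weight of this state in the performance
        difference vanishes too.\<close>
      then show ?thesis
        using discount_bounds cone_error_const_nonneg kkt_residual_nonneg[of D \<mu> "(\<pi>, V, \<Lambda>)"]
        by (simp add: occupancy_eq)
    next
      case False
      let ?x = "visitation \<nu> \<pi>' $ s" and ?y = "visitation \<mu> \<pi> $ s"
      let ?A = "inner (\<pi>' $ s) (q_vec D \<pi> s) - value_vec D \<pi> $ s"
      have "occupancy D \<mu> \<pi> $ s \<noteq> 0"
        and ratio: "occupancy D \<nu> \<pi>' $ s / occupancy D \<mu> \<pi> $ s \<le> c"
        using ratio_norm_leD[OF mis[unfolded mismatch_2_def] component_le_norm_cart
            occupancy_nonneg[OF pi'] False] by auto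
      then have y: "0 < ?y"
        using visitation_nonneg[OF pi, of \<mu> s] by (simp add: occupancy_eq)
      \<comment> \<open>The factors 1 - \<gamma> of the two occupancies cancel.\<close>
      have ratio: "0 \<le> ?x / ?y" "?x / ?y \<le> \<bar>c\<bar>"
        using ratio discount_bounds y visitation_nonneg[OF pi', of \<nu> s]
        by (auto simp: occupancy_eq)
      \<comment> \<open>The value at s is the average of Q under \<pi>, so the left side pairs
        \<open>?y\<close> times Q with \<pi>' - \<pi>; the normal vector is added and
        subtracted.\<close>
      have "?y * ?A = inner (n s) (\<pi>' $ s - \<pi> $ s)
          - inner (n s - ?y *\<^sub>R q_vec D \<pi> s) (\<pi>' $ s - \<pi> $ s)"
        by (simp add: value_vec_nth[OF pi] inner_diff inner_commute algebra_simps)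
      also have "\<dots> \<le> norm (n s - ?y *\<^sub>R q_vec D \<pi> s) * norm (\<pi>' $ s - \<pi> $ s)"
      proof -
        have "inner (n s) (\<pi>' $ s - \<pi> $ s) \<le> 0"
          using n[of s] policiesD[OF pi'] by (simp add: normal_cone_def)
        then show ?thesis
          using Cauchy_Schwarz_ineq2[of "n s - ?y *\<^sub>R q_vec D \<pi> s" "\<pi>' $ s - \<pi> $ s"] by linarith
      qed
      \<comment> \<open>The factor 2 bounds the distance of two points of the simplex, each of norm
        at most 1.\<close>
      also have "\<dots> \<le> (cone_error_const * ?g) * 2"
        using norm_triangle_ineq4[of "\<pi>' $ s" "\<pi> $ s"] norm_prob_simplex_le[OF policiesD[OF pi', of s]]
          norm_prob_simplex_le[OF policiesD[OF pi, of s]] err[of s]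
        by (intro mult_mono) (auto intro: order_trans[OF norm_ge_zero])
      finally have yA: "?y * ?A \<le> 2 * cone_error_const * ?g" by (simp add: mult_ac)
      have "?x * ?A = ?x / ?y * (?y * ?A)" using y by simp
      also have "\<dots> \<le> ?x / ?y * (2 * cone_error_const * ?g)" by (intro mult_left_mono yA ratio)
      also have "\<dots> \<le> \<bar>c\<bar> * (2 * cone_error_const * ?g)"
        using cone_error_const_nonneg kkt_residual_nonneg[of D \<mu> "(\<pi>, V, \<Lambda>)"]
        by (intro mult_right_mono ratio) auto
      finally show ?thesis .
    qed
    then have "?gap \<le> (\<Sum>s\<in>(UNIV :: 's set). \<bar>c\<bar> * (2 * cone_error_const * ?g))"
      unfolding performance_difference[OF pi' pi] by (rule sum_mono)
    also have "\<dots> = ?c2 * ?g" by simp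
    also have "\<dots> \<le> (?c1 + ?c2) * ?g"
      using c1 kkt_residual_nonneg[of D \<mu> "(\<pi>, V, \<Lambda>)"] by (intro mult_right_mono) auto
    finally show ?thesis .
  qed
qed

text \<open>For G > 1 the trivial bound is at most itself times G. For G \<le> 1,
  \<open>improve\<close> replaces the gap at a state by a squared distance of order sqrt G, which
  makes the estimate linear in G.\<close>

lemma performance_gap_le_kkt:
  assumes pi': "\<pi>' \<in> policies" and pi: "\<pi> \<in> policies" and b: "0 < b"
    and improve: "\<And>s. occupancy D \<nu> \<pi>' $ s > 0 \<Longrightarrow>
       improvement_gap D \<pi> s \<le> 1 / (2 * b) * (bellman_stationarity D \<pi> s)\<^sup>2"
    and mis: "mismatch_inf D \<pi>' \<pi> \<nu> \<mu> \<le> ereal c"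
  shows "performance D \<nu> \<pi>' - performance D \<nu> \<pi>
    \<le> (2 * \<kappa> * Rmax + real CARD('s) * (\<bar>c\<bar> * (1 / (2 * b) * cone_error_const\<^sup>2)))
       * kkt_residual D \<mu> (\<pi>, V, \<Lambda>)"
    (is "?gap \<le> (?c1 + ?c2) * ?G")
proof -
  have c1: "0 \<le> ?c1" using discount_bounds Rmax_nonneg by simp
  have c2: "0 \<le> ?c2" using b by simp
  have G0: "0 \<le> ?G" by (rule kkt_residual_nonneg)
  show ?thesis
  proof (cases "?G \<le> 1")
    case False
    then have "?c1 \<le> (?c1 + ?c2) * ?G" using c1 c2 mult_mono[of ?c1 "?c1 + ?c2" 1 ?G] by simp
    then show ?thesis using performance_gap_le_const[OF pi' pi, of \<nu>] by linarith
  next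
    case True
    obtain n where n: "\<And>s. n s \<in> normal_cone prob_simplex (\<pi> $ s)"
      and err: "\<And>s. norm (n s - visitation \<mu> \<pi> $ s *\<^sub>R q_vec D \<pi> s) \<le> cone_error_const * sqrt ?G"
      using kkt_residual_imp_near_normal[OF pi True] by blast
    have "visitation \<nu> \<pi>' $ s * (inner (\<pi>' $ s) (q_vec D \<pi> s) - value_vec D \<pi> $ s)
        \<le> \<bar>c\<bar> * (1 / (2 * b) * (cone_error_const\<^sup>2 * ?G))" for s
    proof (cases "occupancy D \<nu> \<pi>' $ s = 0")
      case True
      then show ?thesis
        using discount_bounds G0 b by (simp add: occupancy_eq)
    next
      case False
      let ?x = "visitation \<nu> \<pi>' $ s" and ?y = "visitation \<mu> \<pi> $ s"
      let ?Q = "q_vec D \<pi> s"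
      have "(\<chi> s. (occupancy D \<mu> \<pi> $ s)\<^sup>2) $ s \<noteq> 0"
        and ratio: "occupancy D \<nu> \<pi>' $ s / (\<chi> s. (occupancy D \<mu> \<pi> $ s)\<^sup>2) $ s \<le> c"
        using ratio_norm_leD[OF mis[unfolded mismatch_inf_def] component_le_infnorm_cart
            occupancy_nonneg[OF pi'] False] by auto
      then have y: "0 < ?y"
        using visitation_nonneg[OF pi, of \<mu> s] by (simp add: occupancy_eq)
      have x: "0 \<le> ?x" by (rule visitation_nonneg[OF pi'])
      \<comment> \<open>The squared denominator leaves one factor 1 - \<gamma> over, which is then
        bounded by 1.\<close>
      have "?x / ?y\<^sup>2 = (1 - \<gamma>) * (occupancy D \<nu> \<pi>' $ s / (occupancy D \<mu> \<pi> $ s)\<^sup>2)"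
        using discount_bounds by (simp add: occupancy_eq power2_eq_square)
      also have "\<dots> \<le> (1 - \<gamma>) * \<bar>c\<bar>"
        using ratio discount_bounds by (intro mult_left_mono) auto
      also have "\<dots> \<le> \<bar>c\<bar>" using discount_bounds by (intro mult_left_le_one_le) auto
      finally have ratio: "?x / ?y\<^sup>2 \<le> \<bar>c\<bar>" .
      \<comment> \<open>Normal cones are closed under nonnegative scaling, so n / \<open>?y\<close>
        competes in the infimum that defines the stationarity measure.\<close>
      have "(1 / ?y) *\<^sub>R n s \<in> normal_cone prob_simplex (\<pi> $ s)"
        using scaleR_in_normal_cone[OF n, of "1 / ?y" s] y by simp
      then have "bellman_stationarity D \<pi> s \<le> dist 0 (- ?Q + (1 / ?y) *\<^sub>R n s)"
        unfolding bellman_stationarity_def by (intro infdist_le) auto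
      also have "- ?Q + (1 / ?y) *\<^sub>R n s = (1 / ?y) *\<^sub>R (n s - ?y *\<^sub>R ?Q)"
        using y by (simp add: algebra_simps)
      also have "dist 0 \<dots> = norm (n s - ?y *\<^sub>R ?Q) / ?y" using y by simp
      also have "\<dots> \<le> cone_error_const * sqrt ?G / ?y"
        using err[of s] y by (intro divide_right_mono) auto
      finally have "(bellman_stationarity D \<pi> s)\<^sup>2 \<le> (cone_error_const * sqrt ?G / ?y)\<^sup>2"
        by (intro power_mono) (auto simp: bellman_stationarity_def infdist_nonneg)
      also have "\<dots> = cone_error_const\<^sup>2 * ?G / ?y\<^sup>2"
        using G0 by (simp add: power_divide power_mult_distrib)
      finally have stat: "(bellman_stationarity D \<pi> s)\<^sup>2 \<le> cone_error_const\<^sup>2 * ?G / ?y\<^sup>2" .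
      \<comment> \<open>An average over actions is at most the maximum, so the improvement gap
        dominates the advantage of \<pi>' at s.\<close>
      have "inner (\<pi>' $ s) ?Q \<le> (\<Sum>a\<in>UNIV. \<pi>' $ s $ a * Max (range (\<lambda>a. ?Q $ a)))"
        using policiesD[OF pi', of s] unfolding inner_vec_def
        by (auto intro!: sum_mono mult_left_mono simp: prob_simplex_iff)
      also have "\<dots> = Max (range (\<lambda>a. ?Q $ a))"
        using policiesD[OF pi', of s] by (simp add: prob_simplex_iff flip: sum_distrib_right)
      finally have "inner (\<pi>' $ s) ?Q - value_vec D \<pi> $ s \<le> improvement_gap D \<pi> s"
        by (simp add: improvement_gap_def)
      also have "\<dots> \<le> 1 / (2 * b) * (bellman_stationarity D \<pi> s)\<^sup>2"
        using occupancy_nonneg[OF pi', of \<nu> s] False by (intro improve) auto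
      also have "\<dots> \<le> 1 / (2 * b) * (cone_error_const\<^sup>2 * ?G / ?y\<^sup>2)"
        using b by (intro mult_left_mono stat) auto
      finally have "?x * (inner (\<pi>' $ s) ?Q - value_vec D \<pi> $ s)
          \<le> ?x * (1 / (2 * b) * (cone_error_const\<^sup>2 * ?G / ?y\<^sup>2))"
        using x by (rule mult_left_mono)
      \<comment> \<open>Squaring the distance has squared \<open>1 / ?y\<close>; hence the squared
        occupancy in \<open>mismatch_inf\<close>.\<close>
      also have "\<dots> = ?x / ?y\<^sup>2 * (1 / (2 * b) * (cone_error_const\<^sup>2 * ?G))" by simp
      also have "\<dots> \<le> \<bar>c\<bar> * (1 / (2 * b) * (cone_error_const\<^sup>2 * ?G))"
        using b G0 by (intro mult_right_mono ratio) auto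
      finally show ?thesis .
    qed
    then have "?gap \<le> (\<Sum>s\<in>(UNIV :: 's set). \<bar>c\<bar> * (1 / (2 * b) * (cone_error_const\<^sup>2 * ?G)))"
      unfolding performance_difference[OF pi' pi] by (rule sum_mono)
    also have "\<dots> = ?c2 * ?G" by simp
    also have "\<dots> \<le> (?c1 + ?c2) * ?G" using c1 G0 by (intro mult_right_mono) auto
    finally show ?thesis .
  qed
qed

end

section \<open>Invariants of the iteration: feasible policies, finitely many outcomes\<close>

lemma arg_min_on_in:
  fixes f :: "'v::metric_space \<Rightarrow> real"
  assumes "compact X" "X \<noteq> {}" "continuous_on X f"
  shows "arg_min_on f X \<in> X"
proof -
  obtain x where "x \<in> X" "\<forall>y\<in>X. f x \<le> f y"
    using continuous_attains_inf[OF assms] by blast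
  then have "is_arg_min f (\<lambda>x. x \<in> X) x" by (fastforce simp: is_arg_min_def)
  \<comment> \<open>\<open>arg_min_on\<close> is a choice among minimizers; it has the defining
    property once some minimizer exists.\<close>
  then have "is_arg_min f (\<lambda>x. x \<in> X) (arg_min_on f X)"
    unfolding arg_min_on_def arg_min_def by (rule someI)
  then show ?thesis by (simp add: is_arg_min_def)
qed

lemma compact_policies: "compact (policies :: ('s::finite, 'a::finite) policy set)"
proof -
  have "norm \<pi> \<le> real CARD('s)" if "\<pi> \<in> policies" for \<pi> :: "('s, 'a) policy"
  proof -
    have "norm \<pi> \<le> (\<Sum>s\<in>UNIV. norm (\<pi> $ s))"
      unfolding norm_vec_def by (rule L2_set_le_sum) simp
    also have "\<dots> \<le> (\<Sum>s\<in>(UNIV :: 's set). 1)"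
      by (intro sum_mono norm_prob_simplex_le policiesD that)
    finally show ?thesis by simp
  qed
  then have "bounded (policies :: ('s, 'a) policy set)" by (auto simp: bounded_iff)
  moreover have "closed (policies :: ('s, 'a) policy set)"
    unfolding policies_def prob_simplex_iff
    by (intro closed_Collect_all closed_Collect_conj closed_Collect_le closed_Collect_eq continuous_intros)
  ultimately show ?thesis by (simp add: compact_eq_bounded_closed)
qed

lemma continuous_on_emp_lagrangian:
  fixes D :: "('s::finite, 'a::finite) mdp"
  shows "continuous_on X (\<lambda>p. emp_lagrangian D S \<mu> b p V \<Lambda>)"
proof -
  \<comment> \<open>Finite sums of products in the entries of \<open>p\<close> put the residual
    within reach of the continuity rules.\<close>
  have "emp_residual D S b p V = (\<chi> s. (\<Sum>s'\<in>UNIV. ((mat 1 :: real ^ 's ^ 's) $ s $ s'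
      - discount D * (\<Sum>a\<in>UNIV. p $ s $ a * emp_kernel S b s a s')) * V $ s')
      - (\<Sum>a\<in>UNIV. p $ s $ a * emp_reward S b s a))" for p
    by (simp add: emp_residual_def bellman_residual_def system_matrix_def policy_reward_def
        matrix_vector_mult_def vec_eq_iff)
  then show ?thesis
    unfolding emp_lagrangian_def by (auto intro!: continuous_intros)
qed

text \<open>The policy update minimizes a continuous function over a nonempty compact set.\<close>

lemma fst_admm_step_in_policies:
  assumes "fst z \<in> policies" shows "fst (admm_step D S \<mu> z b) \<in> policies"
proof -
  obtain \<pi> V \<Lambda> where z: "z = (\<pi>, V, \<Lambda>)" by (cases z)
  show ?thesis
    using assms unfolding z admm_step_def Let_def prod.case fst_conv
    by (intro arg_min_on_in compact_policies continuous_intros continuous_on_emp_lagrangian) auto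
qed

lemma fst_iterate_in_policies:
  assumes "fst (init S) \<in> policies" shows "fst (iterate D S \<mu> h k) \<in> policies"
proof -
  have "fst (foldl (admm_step D S \<mu>) z bs) \<in> policies" if "fst z \<in> policies" for z bs
    using that by (induction bs arbitrary: z) (simp_all add: fst_admm_step_in_policies del: split_paired_All)
  then show ?thesis using assms by (simp add: iterate_def)
qed

text \<open>The policy of \<open>companion\<close> is that of the next iterate, so feasibility of
  the iterates carries over.\<close>

lemma fst_output_in_policies:
  assumes "is_admm S" "z \<in> set_pmf (output_pmf D S \<mu> m T)"
  shows "fst z \<in> policies"
  using assms fst_iterate_in_policies[of S D \<mu>]
  by (auto simp: output_pmf_def companion_def is_admm_def Let_def split: prod.splits)

text \<open>The reward in a transition is a function of state and action, so a step has finitely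
  many outcomes although transitions carry a real number.\<close>

lemma finite_set_batch_pmf: "finite (set_pmf (batch_pmf D b n (s :: 's::finite) :: ('s, 'a::finite) batch pmf))"
proof (induction n arbitrary: s)
  case (Suc n)
  have "finite (set_pmf (step_pmf D b s))" for s :: 's and b :: "'s \<Rightarrow> 'a pmf"
    by (simp add: step_pmf_def set_bind_pmf)
  then show ?case using Suc by (simp add: set_bind_pmf)
qed simp

text \<open>Each batch adds finitely many outcomes to the history, and 0 < T makes the range of the
  random index nonempty, as \<open>pmf_of_set\<close> requires.\<close>

lemma finite_set_output_pmf: "0 < T \<Longrightarrow> finite (set_pmf (output_pmf D S \<mu> m T))"
proof -
  assume "0 < T"
  have "finite (set_pmf (history_pmf D S m k))" for k
    by (induction k) (simp_all add: set_bind_pmf finite_set_batch_pmf)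
  then show ?thesis using \<open>0 < T\<close> by (simp add: output_pmf_def)
qed

section \<open>Expectations under laws of finite support\<close>

lemma expectation_sqrt_le:
  fixes f :: "'b \<Rightarrow> real"
  assumes fin: "finite (set_pmf p)" and nonneg: "\<And>x. 0 \<le> f x"
  shows "measure_pmf.expectation p (\<lambda>x. sqrt (f x)) \<le> sqrt (measure_pmf.expectation p f)"
proof (rule real_le_rsqrt)
  \<comment> \<open>Jensen's inequality for the square root is the nonnegativity of the variance of
    sqrt f.\<close>
  have "0 \<le> measure_pmf.variance p (\<lambda>x. sqrt (f x))"
    by (rule measure_pmf.variance_positive)
  also have "\<dots> = measure_pmf.expectation p f - (measure_pmf.expectation p (\<lambda>x. sqrt (f x)))\<^sup>2"
    by (subst measure_pmf.variance_eq) (simp_all add: integrable_measure_pmf_finite fin nonneg)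
  finally show "(measure_pmf.expectation p (\<lambda>x. sqrt (f x)))\<^sup>2 \<le> measure_pmf.expectation p f"
    by simp
qed

lemma expectation_mono:
  fixes f g :: "'b \<Rightarrow> real"
  assumes "finite (set_pmf p)" "\<And>x. x \<in> set_pmf p \<Longrightarrow> f x \<le> g x"
  shows "measure_pmf.expectation p f \<le> measure_pmf.expectation p g"
  using assms by (intro integral_mono_AE) (auto simp: integrable_measure_pmf_finite AE_measure_pmf_iff)

theorem theorem6p9:
  fixes D :: "('s::finite, 'a::finite) mdp"
    and S :: "('s, 'a) admm"
    and \<mu> \<nu> :: "'s pmf"
    and \<pi>opt :: "('s, 'a) policy"
    and Rmax A B :: real
  assumes "is_mdp D Rmax"
    and "is_admm S"
    and "maximizes_performance D \<nu> \<pi>opt"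
    and "A > 0" and "B > 0"
  shows
    "(\<forall>Cocc :: real. \<exists>C :: real. \<forall>(m :: nat \<Rightarrow> nat) (T :: nat).
        (\<forall>k. m k \<ge> 1) \<longrightarrow> T \<ge> 1 \<longrightarrow> finite_time_bound D S \<mu> A B m T \<longrightarrow>
        (\<forall>\<pi>\<in>output_policies D S \<mu> m T. mismatch_2 D \<pi>opt \<pi> \<nu> \<mu> \<le> ereal Cocc) \<longrightarrow>
        expected_gap D S \<mu> \<nu> \<pi>opt m T \<le> C * sqrt (expected_kkt D S \<mu> m T))
     \<and> (\<forall>(Cocc :: real) (m :: nat \<Rightarrow> nat \<Rightarrow> nat) (T :: nat \<Rightarrow> nat).
        (\<forall>n. (\<forall>k. m n k \<ge> 1) \<and> T n \<ge> 1 \<and> finite_time_bound D S \<mu> A B (m n) (T n) \<and>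
             (\<forall>\<pi>\<in>output_policies D S \<mu> (m n) (T n). mismatch_2 D \<pi>opt \<pi> \<nu> \<mu> \<le> ereal Cocc)) \<longrightarrow>
        (\<lambda>n. expected_kkt D S \<mu> (m n) (T n)) \<longlonglongrightarrow> 0 \<longrightarrow>
        (\<lambda>n. measure_pmf.expectation (output_pmf D S \<mu> (m n) (T n)) (\<lambda>z. performance D \<nu> (fst z)))
          \<longlonglongrightarrow> performance D \<nu> \<pi>opt)
     \<and> (\<forall>(Cocc :: real) (z :: nat \<Rightarrow> ('s, 'a) policy \<times> (real ^ 's) \<times> (real ^ 's)).
        (\<forall>n. fst (z n) \<in> policies \<and> mismatch_2 D \<pi>opt (fst (z n)) \<nu> \<mu> \<le> ereal Cocc) \<longrightarrow>
        (\<lambda>n. kkt_residual D \<mu> (z n)) \<longlonglongrightarrow> 0 \<longrightarrow>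
        (\<lambda>n. performance D \<nu> (fst (z n))) \<longlonglongrightarrow> performance D \<nu> \<pi>opt)
     \<and> (\<forall>(\<pi> :: ('s, 'a) policy) (V :: real ^ 's) (\<Lambda> :: real ^ 's).
        \<pi> \<in> policies \<longrightarrow> kkt_residual D \<mu> (\<pi>, V, \<Lambda>) = 0 \<longrightarrow>
        {s. occupancy D \<nu> \<pi>opt $ s \<noteq> 0} \<subseteq> {s. occupancy D \<mu> \<pi> $ s \<noteq> 0} \<longrightarrow>
        maximizes_performance D \<nu> \<pi>)
     \<and> (\<forall>(\<mu>B :: real) (Docc :: real). \<mu>B > 0 \<longrightarrow>
        (\<exists>C' :: real. \<forall>(m :: nat \<Rightarrow> nat) (T :: nat).
          (\<forall>k. m k \<ge> 1) \<longrightarrow> T \<ge> 1 \<longrightarrow> finite_time_bound D S \<mu> A B m T \<longrightarrow>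
          (\<forall>\<pi>\<in>output_policies D S \<mu> m T. \<forall>s. occupancy D \<nu> \<pi>opt $ s > 0 \<longrightarrow>
             improvement_gap D \<pi> s \<le> 1 / (2 * \<mu>B) * (bellman_stationarity D \<pi> s)\<^sup>2) \<longrightarrow>
          (\<forall>\<pi>\<in>output_policies D S \<mu> m T. mismatch_inf D \<pi>opt \<pi> \<nu> \<mu> \<le> ereal Docc) \<longrightarrow>
          expected_gap D S \<mu> \<nu> \<pi>opt m T \<le> C' * expected_kkt D S \<mu> m T))"
proof -
  interpret discounted_mdp D Rmax by (standard, fact)
  have opt: "\<pi>opt \<in> policies"
    and opt_ge: "\<And>\<pi>. \<pi> \<in> policies \<Longrightarrow> performance D \<nu> \<pi> \<le> performance D \<nu> \<pi>opt"
    using assms(3) by (auto simp: maximizes_performance_def)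
  have out: "fst z \<in> policies" if "z \<in> set_pmf (output_pmf D S \<mu> m T)" for z m T
    using fst_output_in_policies[OF assms(2) that] .
  \<comment> \<open>The constant depends on the MDP and the mismatch bound alone, so it is fixed
    before the batch schedule and T.\<close>
  define C where "C = (\<lambda>c. 2 * \<kappa> * Rmax + real CARD('s) * (\<bar>c\<bar> * (2 * cone_error_const)))"
  have C0: "0 \<le> C c" for c
    using discount_bounds Rmax_nonneg cone_error_const_nonneg by (simp add: C_def)
  have gap: "performance D \<nu> \<pi>opt - performance D \<nu> (fst z) \<le> C c * sqrt (kkt_residual D \<mu> z)"
    if "fst z \<in> policies" "mismatch_2 D \<pi>opt (fst z) \<nu> \<mu> \<le> ereal c" for z c
    using performance_gap_le_sqrt_kkt[OF opt that, of "fst (snd z)" "snd (snd z)"] by (simp add: C_def)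
  have expected_le: "expected_gap D S \<mu> \<nu> \<pi>opt m T \<le> C c * sqrt (expected_kkt D S \<mu> m T)"
    if T: "T \<ge> 1" and mis: "\<forall>\<pi>\<in>output_policies D S \<mu> m T. mismatch_2 D \<pi>opt \<pi> \<nu> \<mu> \<le> ereal c"
    for c m T
  proof -
    let ?p = "output_pmf D S \<mu> m T"
    have fin: "finite (set_pmf ?p)" using T by (simp add: finite_set_output_pmf)
    have "expected_gap D S \<mu> \<nu> \<pi>opt m T
        \<le> measure_pmf.expectation ?p (\<lambda>z. C c * sqrt (kkt_residual D \<mu> z))"
      unfolding expected_gap_def
      using mis by (intro expectation_mono fin gap out) (auto simp: output_policies_def)
    also have "\<dots> = C c * measure_pmf.expectation ?p (\<lambda>z. sqrt (kkt_residual D \<mu> z))"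
      by simp
    also have "\<dots> \<le> C c * sqrt (measure_pmf.expectation ?p (kkt_residual D \<mu>))"
      by (intro mult_left_mono expectation_sqrt_le fin kkt_residual_nonneg C0)
    finally show ?thesis by (simp add: expected_kkt_def)
  qed
  \<comment> \<open>Shared by the two convergence claims: optimality of \<open>\<pi>opt\<close>
    bounds \<open>y\<close> from above, the gap estimate bounds it from below.\<close>
  have squeeze: "y \<longlonglongrightarrow> performance D \<nu> \<pi>opt"
    if G: "G \<longlonglongrightarrow> 0" and upper: "\<And>n. y n \<le> performance D \<nu> \<pi>opt"
      and lower: "\<And>n. performance D \<nu> \<pi>opt - y n \<le> C c * sqrt (G n)" for y G :: "nat \<Rightarrow> real" and c
  proof (rule tendsto_sandwich)
    have "(\<lambda>n. performance D \<nu> \<pi>opt - C c * sqrt (G n)) \<longlonglongrightarrow> performance D \<nu> \<pi>opt - C c * sqrt 0"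
      by (intro tendsto_intros G)
    then show "(\<lambda>n. performance D \<nu> \<pi>opt - C c * sqrt (G n)) \<longlonglongrightarrow> performance D \<nu> \<pi>opt" by simp
    show "\<forall>\<^sub>F n in sequentially. performance D \<nu> \<pi>opt - C c * sqrt (G n) \<le> y n"
      using lower by (auto simp: algebra_simps)
  qed (use upper in auto)
  show ?thesis
  proof (intro conjI allI impI, goal_cases)
    case (1 c)
    then show ?case using expected_le by blast
  next
    case (2 c m T)
    show ?case
    proof (rule squeeze[OF 2(2), where c = c])
      fix n
      let ?p = "output_pmf D S \<mu> (m n) (T n)"
      have fin: "finite (set_pmf ?p)" using 2(1) by (simp add: finite_set_output_pmf Suc_le_lessD)
      have "measure_pmf.expectation ?p (\<lambda>z. performance D \<nu> (fst z))
          \<le> measure_pmf.expectation ?p (\<lambda>z. performance D \<nu> \<pi>opt)"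
        by (intro expectation_mono fin opt_ge out)
      then show "measure_pmf.expectation ?p (\<lambda>z. performance D \<nu> (fst z)) \<le> performance D \<nu> \<pi>opt"
        by simp
      have "expected_gap D S \<mu> \<nu> \<pi>opt (m n) (T n)
          = performance D \<nu> \<pi>opt - measure_pmf.expectation ?p (\<lambda>z. performance D \<nu> (fst z))"
        unfolding expected_gap_def
        by (subst Bochner_Integration.integral_diff) (simp_all add: integrable_measure_pmf_finite fin)
      then show "performance D \<nu> \<pi>opt - measure_pmf.expectation ?p (\<lambda>z. performance D \<nu> (fst z))
          \<le> C c * sqrt (expected_kkt D S \<mu> (m n) (T n))"
        using expected_le[of "T n" "m n" c] 2(1) by simp
    qed
  next
    case (3 c z)
    show ?case
      by (rule squeeze[OF 3(2), where c = c]) (use 3(1) opt_ge gap in auto)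
  next
    case (4 \<pi> V \<Lambda>)
    \<comment> \<open>Coverage makes the mismatch finite, so its own value can serve as the bound;
      since G = 0, the gap estimate then has right-hand side 0.\<close>
    have "\<not> (\<exists>s. occupancy D \<nu> \<pi>opt $ s > 0 \<and> occupancy D \<mu> \<pi> $ s = 0)"
      using subsetD[OF 4(3)] by force
    then have "mismatch_2 D \<pi>opt \<pi> \<nu> \<mu>
        \<le> ereal (norm (\<chi> s. occupancy D \<nu> \<pi>opt $ s / occupancy D \<mu> \<pi> $ s))"
      by (simp add: mismatch_2_def ratio_norm_def)
    then have "performance D \<nu> \<pi>opt \<le> performance D \<nu> \<pi>"
      using gap[of "(\<pi>, V, \<Lambda>)"] 4(1,2) by fastforce
    then show ?case using 4(1) opt_ge by (force simp: maximizes_performance_def)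
  next
    case (5 b c)
    \<comment> \<open>Again free of the schedule and T: only the MDP, \<open>b\<close> and
      \<open>c\<close> occur.\<close>
    define C' where
      "C' = 2 * \<kappa> * Rmax + real CARD('s) * (\<bar>c\<bar> * (1 / (2 * b) * cone_error_const\<^sup>2))"
    have "expected_gap D S \<mu> \<nu> \<pi>opt m T \<le> C' * expected_kkt D S \<mu> m T"
      if T: "T \<ge> 1"
        and improve: "\<forall>\<pi>\<in>output_policies D S \<mu> m T. \<forall>s. occupancy D \<nu> \<pi>opt $ s > 0 \<longrightarrow>
             improvement_gap D \<pi> s \<le> 1 / (2 * b) * (bellman_stationarity D \<pi> s)\<^sup>2"
        and mis: "\<forall>\<pi>\<in>output_policies D S \<mu> m T. mismatch_inf D \<pi>opt \<pi> \<nu> \<mu> \<le> ereal c" for m T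
    proof -
      let ?p = "output_pmf D S \<mu> m T"
      have "performance D \<nu> \<pi>opt - performance D \<nu> (fst z) \<le> C' * kkt_residual D \<mu> z"
        if z: "z \<in> set_pmf ?p" for z
      proof -
        have "fst z \<in> output_policies D S \<mu> m T" using z by (simp add: output_policies_def)
        then show ?thesis
          using performance_gap_le_kkt[OF opt out[OF z] 5, of \<nu> \<mu> c "fst (snd z)" "snd (snd z)"]
            improve mis by (simp add: C'_def)
      qed
      then have "expected_gap D S \<mu> \<nu> \<pi>opt m T
          \<le> measure_pmf.expectation ?p (\<lambda>z. C' * kkt_residual D \<mu> z)"
        unfolding expected_gap_def using T
        by (intro expectation_mono) (auto simp: finite_set_output_pmf)
      then show ?thesis by (simp add: expected_kkt_def)
    qed
    then show ?case by blast
  qed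
qed

end
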